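(* Let $n,k\ge 1$ and $0\le c<n$ be integers and let $p\in(0,1)$. Let $Z_1,Z_2,\dots$ be i.i.d. random variables following the Binomial distribution with parameters $n,p$, let $$T=\inf\{l\ge k:\ Z_{l-k+1}>c,\dots,Z_l>c\},$$ and let $S_T=\sum_{i=1}^{T}Z_i$. Then the joint probability generating function of $(T,S_T)$ is $$\mathbb{E}(u^{T}t^{S_T})=\frac{\left(q_tu(1-p+pt)^{n}\right)^{k}\left(1-q_tu(1-p+pt)^{n}\right)}{1-u(1-p+pt)^{n}+(1-q_t)q_t^{k}\left(u(1-p+pt)^{n}\right)^{k+1}}$$ for all $u\in[0,1]$ and $t\in(0,1]$, where $$q_t=1-\sum_{x=0}^{c}\binom{n}{x}p_t^{x}(1-p_t)^{n-x},\qquad p_t=\frac{pt}{1-p+pt}.$$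
   Context: Interpretation: $Z_i$ is the number of defective items in the $i$-th sample of size $n$, and $T$ is the waiting time until a switch of sampling level under the $k$-run switching rule, i.e. until $k$ consecutive samples each contain more than $c$ defective items. *)

theory Defs
  imports "HOL-Probability.Probability" "HOL-Library.Extended_Nat"
begin

(* z i is the number of defective items in the i-th sample, i = 1, 2, ...
   The infimum is taken in enat, so it is infinity if there is no such l. *)
definition switch_time :: "nat \<Rightarrow> nat \<Rightarrow> (nat \<Rightarrow> nat) \<Rightarrow> enat" where
  "switch_time k c z = Inf {enat l | l. k \<le> l \<and> (\<forall>i\<in>{l - k + 1..l}. c < z i)}"

(* u^T t^(S_T) as a function of the sample sequence, with value 0 where T is infinite;
   with this convention the formula at u = t = 1 says that T is almost surely finite. *)
definition pgf_term :: "nat \<Rightarrow> nat \<Rightarrow> real \<Rightarrow> real \<Rightarrow> (nat \<Rightarrow> nat) \<Rightarrow> real" where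
  "pgf_term k c u t z =
    (case switch_time k c z of
       enat T \<Rightarrow> u ^ T * t ^ (\<Sum>i=1..T. z i)
     | \<infinity> \<Rightarrow> 0)"

definition tilted_p :: "real \<Rightarrow> real \<Rightarrow> real" where
  "tilted_p p t = p * t / (1 - p + p * t)"

definition tilted_q :: "nat \<Rightarrow> nat \<Rightarrow> real \<Rightarrow> real \<Rightarrow> real" where
  "tilted_q n c p t =
    1 - (\<Sum>x=0..c. real (n choose x) * tilted_p p t ^ x * (1 - tilted_p p t) ^ (n - x))"

end

theory Submission
  imports Defs
begin

text \<open>
  The proof is a first-step analysis. Put $w(a) = u t^a$, so that $u^T t^{S_T}$ is the product of
  $w(Z_i)$ over the samples up to the switch, and let $F_j$ be the expectation of this product for
  an observer who has already seen $j$ consecutive samples with more than $c$ defectives. The next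
  sample either extends the run, contributing $A = E[w(Z); Z > c]$, or destroys it, contributing
  $B = E[w(Z); Z \<le> c]$. Since the remaining samples are again i.i.d.,
  \[ F_k = 1, \qquad F_j = A F_{j+1} + B F_0 \quad (j < k), \]
  which is \<open>expectation_run_weight_step\<close>. Solving this system gives
  $F_0\,(1 - A - B (1 - A^k)) = A^k (1 - A)$ (\<open>expectation_run_weight\<close>), for any distribution of
  the samples and any weight with values in $[0, 1]$.

  The binomial distribution enters only through $A$ and $B$. Weighting it by $t^x$ gives
  $(1 - p + p t)^n$ times the binomial distribution with parameter $p_t$
  (\<open>tilted_binomial_term\<close>), so with $v = u (1 - p + p t)^n$ one has $A = q_t v$ and
  $B = (1 - q_t) v$. As $0 < q_t < 1$ and $0 \<le> v \<le> 1$, the coefficient of $F_0$, which becomes the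
  denominator of the formula, is positive, also in the boundary case $u = t = 1$.
\<close>

section \<open>Waiting for a run with a head start\<close>

text \<open>
  Samples are indexed from $0$ here, and \<open>j\<close> counts the successes seen before sample $0$. If
  $l < k$ then the truncated difference \<open>l - k\<close> is $0$: all samples so far must be successes, and
  together with the head start they make up the run.
\<close>
definition run_at :: "nat \<Rightarrow> nat \<Rightarrow> nat \<Rightarrow> (nat \<Rightarrow> nat) \<Rightarrow> nat \<Rightarrow> bool" where
  "run_at k c j x l \<longleftrightarrow> k \<le> j + l \<and> (\<forall>i\<in>{l - k..<l}. c < x i)"

definition run_weight ::
    "nat \<Rightarrow> nat \<Rightarrow> (nat \<Rightarrow> real) \<Rightarrow> nat \<Rightarrow> (nat \<Rightarrow> nat) \<Rightarrow> real" where
  "run_weight k c w j x =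
    (if \<exists>l. run_at k c j x l then \<Prod>i<(LEAST l. run_at k c j x l). w (x i) else 0)"

lemma run_weight_eq_prod:
  assumes "run_at k c j x l" and "\<And>m. m < l \<Longrightarrow> \<not> run_at k c j x m"
  shows "run_weight k c w j x = (\<Prod>i<l. w (x i))"
proof -
  have "(LEAST m. run_at k c j x m) = l"
    by (intro Least_equality) (use assms in \<open>auto simp: not_less[symmetric]\<close>)
  with assms(1) show ?thesis
    by (auto simp: run_weight_def)
qed

lemma run_weight_full [simp]: "run_weight k c w k x = 1"
  by (subst run_weight_eq_prod[where l = 0]) (auto simp: run_at_def)

text \<open>
  Losing the first sample leaves a wait of the same kind, with the head start extended or reset.
  If $k \<le> l$, the \<open>k\<close> samples in question all lie in the tail, whatever
  the head start; if $l < k$, the run has to contain \<open>a\<close>, and a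
  reset head start is too short for a run within \<open>l\<close> samples.
\<close>
lemma run_at_Suc_case_nat:
  "run_at k c j (case_nat a x) (Suc l) \<longleftrightarrow>
    (if c < a then run_at k c (Suc j) x l else run_at k c 0 x l)"
proof (cases "k \<le> l")
  case True
  then have eq: "{Suc l - k..<Suc l} = Suc ` {l - k..<l}"
    by (simp add: Suc_diff_le)
  from True show ?thesis
    unfolding run_at_def eq by (simp del: image_Suc_atLeastLessThan)
next
  case False
  then have eq: "{Suc l - k..<Suc l} = insert 0 (Suc ` {l - k..<l})"
    by auto
  from False show ?thesis
    unfolding run_at_def eq by (simp del: image_Suc_atLeastLessThan)
qed

text \<open>
  The pathwise form of the first-step recursion. With $j < k$ the wait is not yet over at time $0$,
  so the first sample is always consumed and contributes its weight.
\<close>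
lemma run_weight_case_nat:
  assumes "j < k"
  shows "run_weight k c w j (case_nat a x) =
    w a * (if c < a then run_weight k c w (Suc j) x else run_weight k c w 0 x)"
proof -
  define j' where "j' = (if c < a then Suc j else 0)"
  have Suc_iff: "run_at k c j (case_nat a x) (Suc l) \<longleftrightarrow> run_at k c j' x l" for l
    by (simp add: run_at_Suc_case_nat j'_def)
  have zero: "\<not> run_at k c j (case_nat a x) 0"
    using assms by (simp add: run_at_def)
  have "run_weight k c w j (case_nat a x) = w a * run_weight k c w j' x"
  proof (cases "\<exists>l. run_at k c j' x l")
    case True
    define l where "l = (LEAST l. run_at k c j' x l)"
    have l: "run_at k c j' x l" "\<And>m. m < l \<Longrightarrow> \<not> run_at k c j' x m"
      using LeastI_ex[OF True] not_less_Least unfolding l_def by blast+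
    have "\<not> run_at k c j (case_nat a x) m" if "m < Suc l" for m
      using that zero l(2) by (cases m) (auto simp: Suc_iff)
    then have "run_weight k c w j (case_nat a x) = (\<Prod>i<Suc l. w (case_nat a x i))"
      using l(1) by (intro run_weight_eq_prod) (simp_all add: Suc_iff)
    also have "\<dots> = w a * (\<Prod>i<l. w (x i))"
      by (simp only: prod.lessThan_Suc_shift) simp
    also have "(\<Prod>i<l. w (x i)) = run_weight k c w j' x"
      using l by (intro run_weight_eq_prod[symmetric]) auto
    finally show ?thesis .
  next
    case False
    have "\<not> run_at k c j (case_nat a x) m" for m
      using False zero by (cases m) (auto simp: Suc_iff)
    with False show ?thesis
      by (simp add: run_weight_def)
  qed
  then show ?thesis
    by (simp add: j'_def)
qed

lemma run_weight_bounds: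
  assumes "\<And>a. 0 \<le> w a" "\<And>a. w a \<le> 1"
  shows "0 \<le> run_weight k c w j x" "run_weight k c w j x \<le> 1"
  using assms by (auto simp: run_weight_def intro!: prod_nonneg prod_le_1)

lemma pgf_term_eq_run_weight:
  "pgf_term k c u t z = run_weight k c (\<lambda>a. u * t ^ a) 0 (\<lambda>i. z (Suc i))"
proof -
  define x where "x = (\<lambda>i. z (Suc i))"
  have run: "k \<le> l \<and> (\<forall>i\<in>{l - k + 1..l}. c < z i) \<longleftrightarrow> run_at k c 0 x l" for l
  proof -
    have eq: "{l - k + 1..l} = Suc ` {l - k..<l}"
      by auto
    show ?thesis
      unfolding run_at_def x_def eq by (simp del: image_Suc_atLeastLessThan)
  qed
  have time: "switch_time k c z = Inf {enat l |l. run_at k c 0 x l}"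
    unfolding switch_time_def run ..
  show ?thesis
  proof (cases "\<exists>l. run_at k c 0 x l")
    case True
    define l where "l = (LEAST l. run_at k c 0 x l)"
    have l: "run_at k c 0 x l" "\<And>m. run_at k c 0 x m \<Longrightarrow> l \<le> m"
      using LeastI_ex[OF True] unfolding l_def by (blast intro: Least_le)+
    have "switch_time k c z = enat l"
      unfolding time
    proof (rule antisym)
      show "Inf {enat l |l. run_at k c 0 x l} \<le> enat l"
        using l(1) by (intro Inf_lower) auto
      show "enat l \<le> Inf {enat l |l. run_at k c 0 x l}"
        by (intro Inf_greatest) (use l(2) in auto)
    qed
    moreover have "(\<Sum>i=1..l. z i) = (\<Sum>i<l. x i)"
      by (simp add: x_def sum.atLeast1_atMost_eq)
    moreover have "run_weight k c (\<lambda>a. u * t ^ a) 0 x = (\<Prod>i<l. u * t ^ x i)"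
      using l by (intro run_weight_eq_prod) (auto simp: not_less[symmetric])
    ultimately show ?thesis
      by (simp add: pgf_term_def x_def prod.distrib power_sum)
  next
    case False
    then have "switch_time k c z = \<infinity>"
      unfolding time by (simp add: top_enat_def)
    with False show ?thesis
      by (simp add: pgf_term_def run_weight_def x_def)
  qed
qed

section \<open>First-step analysis for independent samples\<close>

abbreviation iid_seq :: "nat pmf \<Rightarrow> (nat \<Rightarrow> nat) measure" where
  "iid_seq D \<equiv> \<Pi>\<^sub>M i\<in>(UNIV::nat set). measure_pmf D"

lemma measurable_run_weight [measurable]:
  "run_weight k c w j \<in> borel_measurable (iid_seq D)"
proof -
  have [measurable]: "Measurable.pred (iid_seq D) (\<lambda>x. run_at k c j x l)" for l
    unfolding run_at_def by measurable
  have *: "(\<lambda>x. \<Prod>i<l. w (x i)) \<in> borel_measurable (iid_seq D)" for l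
    by measurable
  have [measurable]: "(\<lambda>x. \<Prod>i<(LEAST l. run_at k c j x l). w (x i)) \<in> borel_measurable (iid_seq D)"
    by (rule measurable_compose_countable[where f = "\<lambda>l x. \<Prod>i<l. w (x i)", OF *]) measurable
  show ?thesis
    unfolding run_weight_def[abs_def] by measurable
qed

text \<open>
  An i.i.d. sequence is distributed like an independent first entry put in front of an i.i.d.
  sequence, so Fubini turns the pathwise recursion into one for the expectations.
\<close>
lemma expectation_run_weight_step:
  fixes D :: "nat pmf" and w :: "nat \<Rightarrow> real" and k c :: nat
  assumes w: "\<And>a. 0 \<le> w a" "\<And>a. w a \<le> 1" and "j < k"
  defines "F \<equiv> \<lambda>j. \<integral>x. run_weight k c w j x \<partial>iid_seq D"
  shows "F j = (\<integral>a. w a * indicator {c<..} a \<partial>D) * F (Suc j)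
    + (\<integral>a. w a * indicator {..c} a \<partial>D) * F 0"
proof -
  interpret S: sequence_space "measure_pmf D"
    by unfold_locales
  interpret P: pair_prob_space "measure_pmf D" "iid_seq D"
    by unfold_locales
  let ?h = "\<lambda>(a, x). run_weight k c w j (case_nat a x)"
  have h_meas: "?h \<in> borel_measurable (measure_pmf D \<Otimes>\<^sub>M iid_seq D)"
    by measurable
  then have h_int: "integrable (measure_pmf D \<Otimes>\<^sub>M iid_seq D) ?h"
    by (intro P.integrable_const_bound[where B = 1])
       (use run_weight_bounds[of w] w in auto)
  have w_int: "integrable D (\<lambda>a. w a * indicator X a)" for X
    by (intro measure_pmf.integrable_const_bound[where B = 1])
       (use w in \<open>auto simp: indicator_def\<close>)
  have "F j = (\<integral>x. run_weight k c w j x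
      \<partial>distr (measure_pmf D \<Otimes>\<^sub>M iid_seq D) (iid_seq D) (\<lambda>(a, x). case_nat a x))"
    unfolding F_def by (subst S.PiM_iter) simp
  also have "\<dots> = (\<integral>y. ?h y \<partial>(measure_pmf D \<Otimes>\<^sub>M iid_seq D))"
    by (subst integral_distr) (auto simp: case_prod_unfold)
  also have "\<dots> = (\<integral>a. (\<integral>x. run_weight k c w j (case_nat a x) \<partial>iid_seq D) \<partial>D)"
    using P.integral_fst'[OF h_int] by simp
  also have "\<dots> = (\<integral>a. w a * indicator {c<..} a * F (Suc j) + w a * indicator {..c} a * F 0 \<partial>D)"
    using \<open>j < k\<close> by (intro Bochner_Integration.integral_cong)
      (auto simp: run_weight_case_nat F_def indicator_def)
  also have "\<dots> = (\<integral>a. w a * indicator {c<..} a \<partial>D) * F (Suc j)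
    + (\<integral>a. w a * indicator {..c} a \<partial>D) * F 0"
    using w_int by simp
  finally show ?thesis .
qed

text \<open>
  Going down from $F_k = 1$ gives $F_{k-m} = A^m + B F_0 (1 + A + \dots + A^{m-1})$. Multiplying by
  $1 - A$ sums the geometric series without a division; $m = k$ is an equation for $F_0$ alone.
\<close>
lemma expectation_run_weight:
  fixes D :: "nat pmf" and w :: "nat \<Rightarrow> real" and k c :: nat
  assumes w: "\<And>a. 0 \<le> w a" "\<And>a. w a \<le> 1"
  defines "A \<equiv> \<integral>a. w a * indicator {c<..} a \<partial>D"
    and "B \<equiv> \<integral>a. w a * indicator {..c} a \<partial>D"
  shows "(\<integral>x. run_weight k c w 0 x \<partial>iid_seq D) * (1 - A - B * (1 - A ^ k)) = A ^ k * (1 - A)"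
proof -
  interpret S: prob_space "iid_seq D"
    by (intro prob_space_PiM measure_pmf.prob_space_axioms)
  define F where "F = (\<lambda>j. \<integral>x. run_weight k c w j x \<partial>iid_seq D)"
  have "F (k - m) * (1 - A) = A ^ m * (1 - A) + B * F 0 * (1 - A ^ m)" if "m \<le> k" for m
    using that
  proof (induction m)
    case 0
    have "run_weight k c w k = (\<lambda>_. 1)"
      by (simp add: fun_eq_iff)
    then show ?case
      by (simp add: F_def S.prob_space)
  next
    case (Suc m)
    then have IH: "F (k - m) * (1 - A) = A ^ m * (1 - A) + B * F 0 * (1 - A ^ m)"
      by simp
    have "F (k - Suc m) = A * F (k - m) + B * F 0"
      using expectation_run_weight_step[OF w, of "k - Suc m" k D c] Suc.prems
      by (simp add: F_def A_def B_def Suc_diff_Suc)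
    then have "F (k - Suc m) * (1 - A) = A * (F (k - m) * (1 - A)) + B * F 0 * (1 - A)"
      by (simp add: algebra_simps)
    then show ?case
      unfolding IH by (simp add: algebra_simps)
  qed
  from this[of k] show ?thesis
    by (simp add: F_def algebra_simps)
qed

lemma (in prob_space) indep_vars_inj:
  assumes indep: "indep_vars (\<lambda>_. N) X (range f)" and f: "inj f"
  shows "indep_vars (\<lambda>_. N) (\<lambda>i. X (f i)) UNIV"
  unfolding indep_vars_def2
proof (intro conjI ballI indep_setsI)
  let ?E = "\<lambda>i. {X i -` A \<inter> space M |A. A \<in> sets N}"
  have indep': "indep_sets ?E (range f)"
    using indep by (simp add: indep_vars_def2)
  show "random_variable N (X (f i))" for i
    using indep by (simp add: indep_vars_def2)
  then show "?E (f i) \<subseteq> events" for i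
    by (auto intro: measurable_sets)
  fix A and J assume J: "J \<noteq> {}" "J \<subseteq> UNIV" "finite J" "\<forall>j\<in>J. A j \<in> ?E (f j)"
  have "prob (\<Inter>i\<in>f ` J. A (inv f i)) = (\<Prod>i\<in>f ` J. prob (A (inv f i)))"
    using J f by (intro indep_setsD[OF indep']) auto
  with f show "prob (\<Inter>j\<in>J. A j) = (\<Prod>j\<in>J. prob (A j))"
    by (simp add: prod.reindex inj_on_subset[OF f])
qed

lemma (in prob_space) expectation_indep_eq_iid_seq:
  fixes Z :: "nat \<Rightarrow> 'a \<Rightarrow> nat" and f :: "(nat \<Rightarrow> nat) \<Rightarrow> real"
  assumes indep: "indep_vars (\<lambda>_. count_space UNIV) Z {1..}"
    and distr: "\<And>i. 1 \<le> i \<Longrightarrow> distr M (count_space UNIV) (Z i) = measure_pmf D"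
    and f: "f \<in> borel_measurable (iid_seq D)"
  shows "expectation (\<lambda>\<omega>. f (\<lambda>i. Z (Suc i) \<omega>)) = (\<integral>x. f x \<partial>iid_seq D)"
proof -
  let ?X = "\<lambda>i. Z (Suc i)" and ?S = "\<Pi>\<^sub>M i\<in>(UNIV::nat set). count_space (UNIV :: nat set)"
  have sets: "sets ?S = sets (iid_seq D)"
    by (intro sets_PiM_cong) simp_all
  have "range Suc = {1..}"
    by (auto simp: image_iff) (metis Suc_le_D)
  with indep have indep': "indep_vars (\<lambda>_. count_space UNIV) ?X UNIV"
    by (intro indep_vars_inj) simp_all
  then have rv [measurable]: "random_variable (count_space UNIV) (?X i)" for i
    by (simp add: indep_vars_def)
  have "distr M ?S (\<lambda>\<omega> i. ?X i \<omega>) = (\<Pi>\<^sub>M i\<in>UNIV. distr M (count_space UNIV) (?X i))"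
    using indep' indep_vars_iff_distr_eq_PiM
      [where I = UNIV and M' = "\<lambda>_. count_space UNIV" and X = ?X] rv
    by (simp add: restrict_UNIV)
  also have "\<dots> = iid_seq D"
    using distr by simp
  finally have "(\<integral>x. f x \<partial>iid_seq D) = (\<integral>x. f x \<partial>distr M ?S (\<lambda>\<omega> i. ?X i \<omega>))"
    by simp
  also have "\<dots> = expectation (\<lambda>\<omega>. f (\<lambda>i. Z (Suc i) \<omega>))"
  proof (rule integral_distr)
    show "(\<lambda>\<omega> i. ?X i \<omega>) \<in> M \<rightarrow>\<^sub>M ?S"
      by (intro measurable_PiM_single') (auto simp: rv)
    show "f \<in> borel_measurable ?S"
      using f by (simp cong: measurable_cong_sets add: sets)
  qed
  finally show ?thesis ..
qed

section \<open>Tilting the binomial distribution\<close>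

lemma tilted_p_bounds:
  assumes "0 < p" "p < 1" "0 < t"
  shows "0 < tilted_p p t" "tilted_p p t < 1"
  using assms by (auto simp: tilted_p_def add_pos_pos)

text \<open>
  With $s = 1 - p + p t$ one has $p t = s\,p_t$ and $1 - p = s (1 - p_t)$, and the $n$ factors
  $s$ do not depend on \<open>x\<close>.
\<close>
lemma tilted_binomial_term:
  assumes "0 < p" "p < 1" "0 < t" "x \<le> n"
  shows "real (n choose x) * p ^ x * (1 - p) ^ (n - x) * t ^ x =
    (1 - p + p * t) ^ n * (real (n choose x) * tilted_p p t ^ x * (1 - tilted_p p t) ^ (n - x))"
proof -
  define s where "s = 1 - p + p * t"
  have s: "s > 0"
    using assms by (simp add: s_def add_pos_pos)
  have "tilted_p p t * s = p * t"
    using s by (simp add: tilted_p_def s_def)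
  moreover from this have "(1 - tilted_p p t) * s = 1 - p"
    by (simp add: left_diff_distrib) (simp add: s_def)
  ultimately have "p ^ x * (1 - p) ^ (n - x) * t ^ x
      = (tilted_p p t * s) ^ x * ((1 - tilted_p p t) * s) ^ (n - x)"
    by (simp add: power_mult_distrib)
  also have "\<dots> = s ^ (x + (n - x)) * (tilted_p p t ^ x * (1 - tilted_p p t) ^ (n - x))"
    by (simp add: power_mult_distrib power_add)
  finally show ?thesis
    using assms(4) by (simp add: s_def algebra_simps)
qed

lemma tilted_q_eq_upper:
  assumes "c < n"
  shows "tilted_q n c p t =
    (\<Sum>x\<in>{c<..n}. real (n choose x) * tilted_p p t ^ x * (1 - tilted_p p t) ^ (n - x))"
proof -
  let ?g = "\<lambda>x. real (n choose x) * tilted_p p t ^ x * (1 - tilted_p p t) ^ (n - x)"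
  have "1 = (tilted_p p t + (1 - tilted_p p t)) ^ n"
    by simp
  also have "\<dots> = sum ?g {..n}"
    unfolding binomial_ring by simp
  also have "{..n} = {0..c} \<union> {c<..n}"
    using assms by auto
  also have "sum ?g \<dots> = sum ?g {0..c} + sum ?g {c<..n}"
    by (intro sum.union_disjoint) auto
  finally show ?thesis
    by (simp add: tilted_q_def)
qed

lemma tilted_q_bounds:
  assumes "0 < p" "p < 1" "0 < t" "c < n"
  shows "0 < tilted_q n c p t" "tilted_q n c p t < 1"
proof -
  note r = tilted_p_bounds[OF assms(1-3)]
  show "0 < tilted_q n c p t"
    unfolding tilted_q_eq_upper[OF assms(4)] using r assms(4) by (intro sum_pos) auto
  have "0 < (\<Sum>x=0..c. real (n choose x) * tilted_p p t ^ x * (1 - tilted_p p t) ^ (n - x))"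
    using r assms(4) by (intro sum_pos) auto
  then show "tilted_q n c p t < 1"
    by (simp add: tilted_q_def)
qed

lemma expectation_binomial_restricted:
  fixes u :: real
  assumes "0 < p" "p < 1" "0 < t"
  shows "(\<integral>a. u * t ^ a * indicator X a \<partial>binomial_pmf n p) = u * (1 - p + p * t) ^ n *
    (\<Sum>x\<in>{..n} \<inter> X. real (n choose x) * tilted_p p t ^ x * (1 - tilted_p p t) ^ (n - x))"
    (is "_ = _ * sum ?g _")
proof -
  have "(\<integral>a. u * t ^ a * indicator X a \<partial>binomial_pmf n p) =
      (\<Sum>x\<le>n. real (n choose x) * p ^ x * (1 - p) ^ (n - x) * (u * t ^ x * indicator X x))"
    using assms by (subst expectation_binomial_pmf') auto
  also have "\<dots> = (\<Sum>x\<le>n. indicator X x *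
      (u * (real (n choose x) * p ^ x * (1 - p) ^ (n - x) * t ^ x)))"
    by (simp add: mult_ac)
  also have "\<dots> = (\<Sum>x\<in>{..n} \<inter> X. u * (real (n choose x) * p ^ x * (1 - p) ^ (n - x) * t ^ x))"
    by (simp add: sum_indicator_mult Int_def)
  also have "\<dots> = (\<Sum>x\<in>{..n} \<inter> X. u * ((1 - p + p * t) ^ n * ?g x))"
    using assms by (intro sum.cong refl arg_cong2[where f = "(*)"] tilted_binomial_term) auto
  finally show ?thesis
    by (simp add: sum_distrib_left mult_ac)
qed

theorem mainTheorem7:
  fixes M :: "'a measure" and Z :: "nat \<Rightarrow> 'a \<Rightarrow> nat"
    and n k c :: nat and p u t :: real
  assumes "prob_space M"
    and "1 \<le> n" and "1 \<le> k" and "c < n"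
    and "0 < p" and "p < 1"
    and "prob_space.indep_vars M (\<lambda>_. count_space UNIV) Z {1..}"
    and "\<And>i. 1 \<le> i \<Longrightarrow> distr M (count_space UNIV) (Z i) = measure_pmf (binomial_pmf n p)"
    and "0 \<le> u" and "u \<le> 1" and "0 < t" and "t \<le> 1"
  shows "(\<integral>\<omega>. pgf_term k c u t (\<lambda>i. Z i \<omega>) \<partial>M) =
    ((tilted_q n c p t * u * (1 - p + p * t) ^ n) ^ k
        * (1 - tilted_q n c p t * u * (1 - p + p * t) ^ n))
    / (1 - u * (1 - p + p * t) ^ n
        + (1 - tilted_q n c p t) * tilted_q n c p t ^ k * (u * (1 - p + p * t) ^ n) ^ (k + 1))"
proof -
  interpret prob_space M by fact
  define q where "q = tilted_q n c p t"
  define v where "v = u * (1 - p + p * t) ^ n"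
  define w where "w = (\<lambda>a::nat. u * t ^ a)"
  let ?D = "binomial_pmf n p"
  define G where "G = (\<integral>\<omega>. pgf_term k c u t (\<lambda>i. Z i \<omega>) \<partial>M)"
  have w: "0 \<le> w a" "w a \<le> 1" for a
    using assms(9-12) by (auto simp: w_def intro!: mult_le_one power_le_one)

  have "{..n} \<inter> {c<..} = {c<..n}" and "{..n} \<inter> {..c} = {0..c}"
    using assms(4) by auto
  then have A: "(\<integral>a. w a * indicator {c<..} a \<partial>?D) = q * v"
    and B: "(\<integral>a. w a * indicator {..c} a \<partial>?D) = (1 - q) * v"
    unfolding w_def using assms(4)
    by (simp_all add: expectation_binomial_restricted[OF assms(5,6,11)] tilted_q_eq_upper q_def v_def)
       (simp add: tilted_q_eq_upper[symmetric] tilted_q_def)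
  have "G = (\<integral>x. run_weight k c w 0 x \<partial>iid_seq ?D)"
    unfolding G_def pgf_term_eq_run_weight w_def
    by (rule expectation_indep_eq_iid_seq[OF assms(7,8)]) simp_all
  with expectation_run_weight[of w ?D k c, OF w, unfolded A B]
  have "G * (1 - q * v - (1 - q) * v * (1 - (q * v) ^ k)) = (q * v) ^ k * (1 - q * v)"
    by simp
  then have G: "G * (1 - v + (1 - q) * q ^ k * v ^ (k + 1)) = (q * v) ^ k * (1 - q * v)"
    by (simp add: algebra_simps power_mult_distrib)

  have q: "0 < q" "q < 1"
    using tilted_q_bounds[OF assms(5,6,11,4)] by (simp_all add: q_def)
  have "p * t \<le> p" "0 \<le> p * t"
    using assms(5,11,12) by (auto simp: mult_left_le)
  then have "0 \<le> v" "v \<le> 1"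
    using assms(6,9,10) by (auto simp: v_def intro!: mult_le_one power_le_one)
  have "0 < 1 - v + (1 - q) * q ^ k * v ^ (k + 1)"
    \<comment> \<open>At $v = 1$ the first difference vanishes, and positivity comes from $0 < q < 1$.\<close>
  proof (cases "v = 1")
    case True
    with q show ?thesis by simp
  next
    case False
    with \<open>v \<le> 1\<close> have "0 < 1 - v" by simp
    moreover have "0 \<le> (1 - q) * q ^ k * v ^ (k + 1)"
      using q \<open>0 \<le> v\<close> by simp
    ultimately show ?thesis by (rule add_pos_nonneg)
  qed
  with G have "G = ((q * v) ^ k * (1 - q * v)) / (1 - v + (1 - q) * q ^ k * v ^ (k + 1))"
    by (simp add: eq_divide_eq)
  then show ?thesis
    by (simp add: G_def q_def v_def mult.assoc)
qed

end
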